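(* Let $n\ge 7$ and let $G$ be a bipartite unit rectangle visibility graph with $n$ vertices. Then $$|E(G)|\le 4n-2\lceil\sqrt{n}\,\rceil+5.$$
   Context: A finite simple graph $G$ is a unit rectangle visibility graph (URVG) if its vertices $v$ can be represented by closed unit squares $S_v$ in the plane with sides parallel to the coordinate axes and with pairwise disjoint interiors (squares may touch along their boundaries), in such a way that two distinct vertices $v,w$ are adjacent if and only if there is an unobstructed non-degenerate (positive width) horizontal or vertical band of visibility joining $S_v$ and $S_w$. Here a horizontal band of visibility joining $S_v$ and $S_w$ is given by an open interval $I$ of positive length such that for every $y_0\in I$ the line $y=y_0$ meets the interiors of both $S_v$ and $S_w$, and the part of this line between $S_v$ and $S_w$ (possibly a single point if the squares touch) meets the interior of no other square of the representation; vertical bands are defined analogously with the roles of $x$ and $y$ exchanged. *)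

theory Defs
  imports "HOL-Analysis.Analysis"
begin

definition simple_graph :: "'a set \<Rightarrow> 'a set set \<Rightarrow> bool" where
  "simple_graph V E \<longleftrightarrow> finite V \<and> E \<subseteq> {{u, v} | u v. u \<in> V \<and> v \<in> V \<and> u \<noteq> v}"

definition bipartite :: "'a set \<Rightarrow> 'a set set \<Rightarrow> bool" where
  "bipartite V E \<longleftrightarrow>
     (\<exists>A B. A \<union> B = V \<and> A \<inter> B = {} \<and> (\<forall>e\<in>E. \<exists>a\<in>A. \<exists>b\<in>B. e = {a, b}))"

(* A closed unit square with axis-parallel sides is given by its lower left corner. *)
definition unit_square :: "real \<times> real \<Rightarrow> (real \<times> real) set" where
  "unit_square p = {fst p..fst p + 1} \<times> {snd p..snd p + 1}"

definition hline :: "real \<Rightarrow> (real \<times> real) set" where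
  "hline y = {q. snd q = y}"

(* The part of the line at height y between two squares with disjoint interiors, both of whose
   interiors it meets: the closed segment from the right side of the left square to the left side
   of the right square, a single point if the squares touch there. *)
definition hgap :: "real \<times> real \<Rightarrow> real \<times> real \<Rightarrow> real \<Rightarrow> (real \<times> real) set" where
  "hgap p q y = {min (fst p) (fst q) + 1..max (fst p) (fst q)} \<times> {y}"

definition hvisible :: "'a set \<Rightarrow> ('a \<Rightarrow> real \<times> real) \<Rightarrow> 'a \<Rightarrow> 'a \<Rightarrow> bool" where
  "hvisible V c v w \<longleftrightarrow>
     (\<exists>a b. a < b \<and>
       (\<forall>y\<in>{a<..<b}.
          hline y \<inter> interior (unit_square (c v)) \<noteq> {} \<and>
          hline y \<inter> interior (unit_square (c w)) \<noteq> {} \<and>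
          (\<forall>u\<in>V - {v, w}. hgap (c v) (c w) y \<inter> interior (unit_square (c u)) = {})))"

(* Vertical visibility is horizontal visibility with the two coordinates exchanged. *)
definition vvisible :: "'a set \<Rightarrow> ('a \<Rightarrow> real \<times> real) \<Rightarrow> 'a \<Rightarrow> 'a \<Rightarrow> bool" where
  "vvisible V c v w \<longleftrightarrow> hvisible V (prod.swap \<circ> c) v w"

definition urv_representation ::
    "'a set \<Rightarrow> 'a set set \<Rightarrow> ('a \<Rightarrow> real \<times> real) \<Rightarrow> bool" where
  "urv_representation V E c \<longleftrightarrow>
     (\<forall>v\<in>V. \<forall>w\<in>V. v \<noteq> w \<longrightarrow>
        interior (unit_square (c v)) \<inter> interior (unit_square (c w)) = {} \<and>
        ({v, w} \<in> E \<longleftrightarrow> hvisible V c v w \<or> vvisible V c v w))"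

definition urvg :: "'a set \<Rightarrow> 'a set set \<Rightarrow> bool" where
  "urvg V E \<longleftrightarrow> simple_graph V E \<and> (\<exists>c. urv_representation V E c)"

end

(* Sweep a horizontal line upwards. At a generic height the squares it crosses are ordered from
   left to right, and the horizontal visibilities at that height are the consecutive pairs. When the
   crossed set changes from P to Q, a pair of squares consecutive in the intersection of P and Q that
   is not consecutive in both P and Q has at least two entering or leaving squares between its
   members: a single one would give a triangle, contradicting bipartiteness. Each new leftmost or
   rightmost square accounts for a further entering or leaving square. As every square enters once
   and leaves once, summing over the sweep gives 2 E_H + l + r <= 4 n, where E_H is the number of
   horizontal visibilities and l, r count the squares that are leftmost, rightmost at some height;
   likewise 2 E_V + b + t <= 4 n for the vertical sweep. The vertical projections of the l leftmost
   squares cover those of all squares, and similarly for b, so comparing areas gives n <= l b and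
   likewise n <= r t. By AM-GM, |E| <= 4 n - 2 sqrt n. *)

theory Submission
  imports Defs
begin

section \<open>Consecutive pairs and extreme elements of a finite set on a line\<close>

definition consecutive :: "('a \<Rightarrow> real) \<Rightarrow> 'a set \<Rightarrow> ('a \<times> 'a) set" where
  "consecutive x S =
     {(u, v). u \<in> S \<and> v \<in> S \<and> x u < x v \<and> (\<forall>w\<in>S. \<not> (x u < x w \<and> x w < x v))}"

text \<open>Set-valued, so that it is total and gives the empty set on empty \<open>S\<close>.
  Rightmost elements are obtained by using \<open>\<lambda>v. - x v\<close> in place of
  \<open>x\<close>.\<close>

definition minima :: "('a \<Rightarrow> real) \<Rightarrow> 'a set \<Rightarrow> 'a set" where
  "minima x S = {u \<in> S. \<forall>w\<in>S. x u \<le> x w}"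

lemma consecutive_subset: "consecutive x S \<subseteq> S \<times> S"
  by (auto simp: consecutive_def)

lemma finite_consecutive: "finite S \<Longrightarrow> finite (consecutive x S)"
  by (rule finite_subset[OF consecutive_subset]) simp

lemma minima_nonempty:
  assumes "finite S" "S \<noteq> {}"
  shows "minima x S \<noteq> {}"
proof -
  have "Min (x ` S) \<in> x ` S" using assms by (intro Min_in) auto
  then obtain u where "u \<in> S" "x u = Min (x ` S)" by auto
  then have "u \<in> minima x S" using assms by (auto simp: minima_def)
  then show ?thesis by auto
qed

lemma minima_eq:
  assumes "inj_on x S" "u \<in> minima x S" "v \<in> minima x S"
  shows "u = v"
proof (rule inj_onD[OF assms(1)])
  show "x u = x v" using assms by (intro antisym) (auto simp: minima_def)
qed (use assms in \<open>auto simp: minima_def\<close>)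

lemma card_minima_le_1:
  assumes "inj_on x S" "M \<subseteq> minima x S"
  shows "card M \<le> 1"
proof (cases "finite M")
  case True
  then have "card M \<le> Suc 0"
    using assms minima_eq[OF assms(1)] by (subst card_le_Suc0_iff_eq) blast+
  then show ?thesis by simp
qed simp

text \<open>Projecting each pair to its first member is injective, and only the element
  \<open>m\<close> with the largest \<open>x\<close>-value has no successor.\<close>

lemma card_consecutive:
  assumes fin: "finite S" and ne: "S \<noteq> {}" and inj: "inj_on x S"
  shows "Suc (card (consecutive x S)) = card S"
proof -
  from minima_nonempty[OF fin ne, of "\<lambda>v. - x v"]
  obtain m where m: "m \<in> S" "\<And>w. w \<in> S \<Longrightarrow> x w \<le> x m"
    by (auto simp: minima_def)
  have "inj_on fst (consecutive x S)"
  proof (rule inj_onI, clarsimp)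
    fix u v v' assume a: "(u, v) \<in> consecutive x S" "(u, v') \<in> consecutive x S"
    then have "x v = x v'" by (fastforce simp: consecutive_def)
    then show "v = v'" using a inj by (auto simp: consecutive_def inj_on_def)
  qed
  moreover have "fst ` consecutive x S = S - {m}"
  proof
    show "fst ` consecutive x S \<subseteq> S - {m}"
      using m by (fastforce simp: consecutive_def)
    show "S - {m} \<subseteq> fst ` consecutive x S"
    proof
      fix u assume u: "u \<in> S - {m}"
      then have "x u < x m" using m inj by (metis DiffE inj_onD insertI1 less_eq_real_def)
      then have "minima x {w \<in> S. x u < x w} \<noteq> {}"
        using fin m by (intro minima_nonempty) auto
      then obtain v where v: "v \<in> S" "x u < x v" "\<And>w. w \<in> S \<Longrightarrow> x u < x w \<Longrightarrow> x v \<le> x w"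
        by (auto simp: minima_def)
      then have "(u, v) \<in> consecutive x S" using u by (force simp: consecutive_def)
      then show "u \<in> fst ` consecutive x S" by force
    qed
  qed
  ultimately have "card (consecutive x S) = card (S - {m})"
    by (metis card_image)
  then show ?thesis using m fin by (metis card_Suc_Diff1)
qed

section \<open>Change of consecutive pairs and extremes from one set to the next\<close>

text \<open>A new minimum \<open>u\<close> either has just entered, and serves as \<open>z\<close>
  itself, or was already in \<open>P\<close> behind some smaller \<open>w\<close>, which must then
  have left.\<close>

lemma new_minimum_outside:
  assumes P: "inj_on x P" and Q: "inj_on x Q"
    and u: "u \<in> minima x Q - minima x P"
  shows "\<exists>z \<in> (P - Q) \<union> (Q - P). \<forall>k \<in> P \<inter> Q. x z < x k"
proof (cases "u \<in> P")
  case True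
  then obtain w where w: "w \<in> P" "x w < x u" using u by (auto simp: minima_def not_le)
  have "w \<notin> Q" using u w by (auto simp: minima_def)
  moreover have "x w < x k" if "k \<in> P \<inter> Q" for k
  proof -
    have "x u \<le> x k" using u that by (simp add: minima_def)
    then show ?thesis using w by simp
  qed
  ultimately show ?thesis using w by blast
next
  case False
  have uQ: "u \<in> Q" using u by (simp add: minima_def)
  have "x u < x k" if k: "k \<in> P \<inter> Q" for k
  proof -
    have "x u \<le> x k" using u k by (simp add: minima_def)
    moreover have "x u \<noteq> x k" using inj_onD[OF Q _ uQ, of k] k False by auto
    ultimately show ?thesis by simp
  qed
  then show ?thesis using uQ False by blast
qed

lemma two_le_card:
  assumes "finite G" "G \<noteq> {}" "\<And>z. G \<noteq> {z}"
  shows "2 \<le> card G"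
proof -
  have "card G \<noteq> 0" "card G \<noteq> 1" using assms by (auto simp: card_1_singleton_iff)
  then show ?thesis by linarith
qed

text \<open>The right-hand side is twice the number of entering elements plus the number of all
  changing elements. Let \<open>K\<close> be the common part, nonempty in the main case, and
  \<open>B\<close> its consecutive pairs that are not consecutive in both \<open>P\<close> and
  \<open>Q\<close>. As a set has one pair fewer than elements, there are
  \<open>card (Q - P) + card B\<close> new pairs. Each pair in \<open>B\<close> is charged to two
  changing elements between its members, and each new extreme to a changing element to the left or
  right of all of \<open>K\<close>. No changing element is charged twice.\<close>

lemma consecutive_step:
  fixes x :: "'a \<Rightarrow> real" and f :: "'a \<Rightarrow> bool"
  assumes P: "finite P" "inj_on x P" and Q: "finite Q" "inj_on x Q"
    and f: "\<And>u v. (u, v) \<in> consecutive x P \<union> consecutive x Q \<Longrightarrow> f u \<noteq> f v"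
  shows "2 * card (consecutive x Q - consecutive x P)
       + card (minima x Q - minima x P)
       + card (minima (\<lambda>v. - x v) Q - minima (\<lambda>v. - x v) P)
       \<le> 3 * card (Q - P) + card (P - Q)"
proof -
  define K where "K = P \<inter> Q"
  define D where "D = (P - Q) \<union> (Q - P)"
  define L where "L = minima x Q - minima x P"
  define R where "R = minima (\<lambda>v. - x v) Q - minima (\<lambda>v. - x v) P"
  have inj': "inj_on (\<lambda>v. - x v) P" "inj_on (\<lambda>v. - x v) Q"
    using P Q by (auto simp: inj_on_def)
  have L1: "card L \<le> 1" and R1: "card R \<le> 1"
    unfolding L_def R_def using card_minima_le_1 Q inj' by (metis Diff_subset)+
  have finD: "finite D" and finK: "finite K" using P Q by (auto simp: D_def K_def)
  have cardD: "card D = card (P - Q) + card (Q - P)"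
    unfolding D_def using P Q by (intro card_Un_disjoint) auto
  have cardQ: "card Q = card (Q - P) + card K"
    unfolding K_def using Q by (metis Int_commute card_Int_Diff add.commute)
  have finC: "finite (consecutive x Q)" using Q finite_consecutive by blast
  show ?thesis
  proof (cases "Q = {}")
    case True
    then show ?thesis by (simp add: consecutive_def minima_def)
  next
    case Qne: False
    have cQ: "Suc (card (consecutive x Q)) = card Q" using card_consecutive Q Qne by blast
    show ?thesis
    proof (cases "K = {}")
      case True
      \<comment> \<open>All of \<open>Q\<close> is new here. Since \<open>Q\<close> has one pair
        fewer than elements, twice the number of pairs leaves a surplus of 2, enough for one new
        minimum and one new maximum.\<close>
      have "card (consecutive x Q - consecutive x P) \<le> card (consecutive x Q)"
        using finC by (intro card_mono) auto
      then show ?thesis using True L1 R1 cQ cardQ unfolding L_def R_def by simp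
    next
      case Kne: False
      have injK: "inj_on x K" using P by (auto simp: K_def inj_on_def)
      have cK: "Suc (card (consecutive x K)) = card K"
        using card_consecutive finK injK Kne by blast
      define C where "C = consecutive x P \<inter> consecutive x Q"
      define B where "B = consecutive x K - C"
      have "C \<subseteq> consecutive x K" by (auto simp: C_def K_def consecutive_def)
      then have cB: "card B + card C = card (consecutive x K)"
        unfolding B_def using finite_consecutive[OF finK]
        by (metis card_Diff_subset card_mono finite_subset le_add_diff_inverse2)
      have cN: "card (consecutive x Q - consecutive x P) + card C = card (consecutive x Q)"
        unfolding C_def using finC by (metis Int_commute card_Int_Diff add.commute)
      \<comment> \<open>\<open>G\<close> collects the changing elements strictly between the members
        of a pair; these are the elements to be charged.\<close>
      define G where "G = (\<lambda>(v, w). {z \<in> D. x v < x z \<and> x z < x w})"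
      have Gdisj: "G p \<inter> G q = {}" if pq: "p \<in> B" "q \<in> B" "p \<noteq> q" for p q
      proof (rule ccontr)
        assume "G p \<inter> G q \<noteq> {}"
        then obtain z where z: "z \<in> G p" "z \<in> G q" by auto
        obtain v w v' w' where e: "p = (v, w)" "q = (v', w')" by fastforce
        have c: "(v, w) \<in> consecutive x K" "(v', w') \<in> consecutive x K"
          using pq e by (auto simp: B_def)
        \<comment> \<open>Both pairs enclose \<open>z\<close>, so \<open>v\<close> and
          \<open>v'\<close> are each the last element of \<open>K\<close> before \<open>z\<close>,
          and \<open>w\<close> and \<open>w'\<close> the first one after it.\<close>
        have "x v = x v'" "x w = x w'"
          using c z unfolding e G_def consecutive_def by fastforce+
        then have "v = v'" "w = w'" using c injK by (auto simp: consecutive_def inj_on_def)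
        then show False using pq e by simp
      qed
      have Gcard: "2 \<le> card (G p)" if p: "p \<in> B" for p
      proof -
        obtain v w where e: "p = (v, w)" by fastforce
        have c: "v \<in> P" "v \<in> Q" "w \<in> P" "w \<in> Q" "x v < x w"
          "\<And>z. z \<in> K \<Longrightarrow> \<not> (x v < x z \<and> x z < x w)"
          using p e by (auto simp: B_def K_def consecutive_def)
        have split: "z \<in> G p" if "z \<in> P \<union> Q" "x v < x z" "x z < x w" for z
          using that c(6)[of z] by (auto simp: G_def e D_def K_def)
        show ?thesis
        proof (rule two_le_card)
          show "finite (G p)" using finD by (auto simp: G_def e)
          show "G p \<noteq> {}"
          proof
            assume "G p = {}"
            then have "(v, w) \<in> C" using split c by (auto simp: C_def consecutive_def)
            then show False using p e by (simp add: B_def)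
          qed
          \<comment> \<open>The element \<open>z\<close> lies in exactly one of \<open>P\<close> and
            \<open>Q\<close>. There \<open>v, z, w\<close> follow one another directly, while in the
            other set \<open>v, w\<close> are consecutive. So \<open>f\<close> would have to take
            three different values on this triangle.\<close>
          show "G p \<noteq> {z}" for z
          proof
            assume Gz: "G p = {z}"
            have z: "x v < x z" "x z < x w" using Gz by (auto simp: G_def e)
            have only: "t = z" if "t \<in> P \<union> Q" "x v < x t" "x t < x w" for t
              using split[OF that] Gz by simp
            have through: "(v, z) \<in> consecutive x S \<and> (z, w) \<in> consecutive x S"
              if S: "S \<subseteq> P \<union> Q" "v \<in> S" "w \<in> S" "z \<in> S" for S
            proof -
              have "\<not> (x v < x t \<and> x t < x z)" "\<not> (x z < x t \<and> x t < x w)" if "t \<in> S" for t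
                using only[of t] that S z by fastforce+
              then show ?thesis using S z by (simp add: consecutive_def)
            qed
            have past: "(v, w) \<in> consecutive x S"
              if S: "S \<subseteq> P \<union> Q" "v \<in> S" "w \<in> S" "z \<notin> S" for S
            proof -
              have "\<not> (x v < x t \<and> x t < x w)" if "t \<in> S" for t
                using only[of t] that S by blast
              then show ?thesis using S c(5) by (simp add: consecutive_def)
            qed
            have zD: "z \<in> D" using Gz by (auto simp: G_def e)
            then consider "z \<in> P" "z \<notin> Q" | "z \<in> Q" "z \<notin> P" by (auto simp: D_def)
            then show False
            proof cases
              case 1
              then show False
                using f[of v z] f[of z w] f[of v w] through[of P] past[of Q] c by blast
            next
              case 2
              then show False
                using f[of v z] f[of z w] f[of v w] through[of Q] past[of P] c by blast
            qed
          qed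
        qed
      qed
      \<comment> \<open>The changing elements to the left and to the right of all of
        \<open>K\<close>. They are disjoint from each other because \<open>K\<close> is nonempty,
        and from every gap \<open>G p\<close> because the ends of \<open>p\<close> lie in
        \<open>K\<close>.\<close>
      define GL where "GL = {z \<in> D. \<forall>k\<in>K. x z < x k}"
      define GR where "GR = {z \<in> D. \<forall>k\<in>K. x k < x z}"
      define GB where "GB = (\<Union>p\<in>B. G p)"
      have finB: "finite B" unfolding B_def using finite_consecutive[OF finK] by auto
      have finG: "finite (G p)" for p using finD by (auto simp: G_def split: prod.split)
      have fins: "finite GL" "finite GR" "finite GB"
        unfolding GL_def GR_def GB_def using finD finB finG by auto
      have "2 * card B = (\<Sum>p\<in>B. 2)" by simp
      also have "\<dots> \<le> (\<Sum>p\<in>B. card (G p))" using Gcard by (intro sum_mono) auto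
      also have "\<dots> = card GB"
        unfolding GB_def using finB finG Gdisj by (intro card_UN_disjoint[symmetric]) auto
      finally have GBc: "2 * card B \<le> card GB" .
      have BK: "v \<in> K \<and> w \<in> K" if "(v, w) \<in> B" for v w
        using that by (auto simp: B_def consecutive_def)
      have "card GL + card GR + card GB = card (GL \<union> GR \<union> GB)"
      proof -
        have "GL \<inter> GR = {}" using Kne by (fastforce simp: GL_def GR_def)
        moreover have "(GL \<union> GR) \<inter> GB = {}"
          using BK unfolding GL_def GR_def GB_def G_def by fastforce
        ultimately show ?thesis using fins by (simp add: card_Un_disjoint)
      qed
      also have "\<dots> \<le> card D"
        using finD by (intro card_mono) (auto simp: GL_def GR_def GB_def G_def)
      finally have sumD: "card GL + card GR + card GB \<le> card D" .
      have GLc: "card L \<le> card GL"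
      proof (cases "L = {}")
        case False
        then obtain u where "u \<in> minima x Q - minima x P" by (auto simp: L_def)
        from new_minimum_outside[OF P(2) Q(2) this] have "GL \<noteq> {}"
          by (auto simp: GL_def D_def K_def)
        then show ?thesis using L1 fins by (simp add: Suc_leI card_gt_0_iff order_trans)
      qed simp
      have GRc: "card R \<le> card GR"
      proof (cases "R = {}")
        case False
        then obtain u where "u \<in> minima (\<lambda>v. - x v) Q - minima (\<lambda>v. - x v) P"
          by (auto simp: R_def)
        from new_minimum_outside[OF inj' this] have "GR \<noteq> {}"
          by (auto simp: GR_def D_def K_def)
        then show ?thesis using R1 fins by (simp add: Suc_leI card_gt_0_iff order_trans)
      qed simp
      show ?thesis
        using GLc GRc GBc sumD cB cN cK cQ cardD cardQ unfolding L_def[symmetric] R_def[symmetric]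
        by linarith
    qed
  qed
qed

section \<open>Summation over a sweep\<close>

text \<open>Starting from the empty set, every member of the union is new at some step. A member
  that disappears and returns is counted again, hence only an inequality.\<close>

lemma card_UN_increments:
  fixes X :: "nat \<Rightarrow> 'b set"
  assumes "X 0 = {}" "\<And>i. finite (X i)"
  shows "card (\<Union>i\<le>r. X i) \<le> (\<Sum>i<r. card (X (Suc i) - X i))"
proof (induction r)
  case 0
  then show ?case using assms by simp
next
  case (Suc r)
  have "(\<Union>i\<le>Suc r. X i) = (\<Union>i\<le>r. X i) \<union> (X (Suc r) - X r)"
    by (auto simp: le_Suc_eq)
  then have "card (\<Union>i\<le>Suc r. X i) \<le> card (\<Union>i\<le>r. X i) + card (X (Suc r) - X r)"
    by (simp add: card_Un_le)
  then show ?case using Suc by simp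
qed

text \<open>By \<open>conv\<close> the indices at which a given element is present form an interval,
  so it enters at most once and leaves at most once. Summing \<open>consecutive_step\<close> then
  charges it at most 3 + 1 = 4.\<close>

lemma sweep_bound:
  fixes A :: "nat \<Rightarrow> 'a set" and x :: "'a \<Rightarrow> real" and f :: "'a \<Rightarrow> bool"
  assumes V: "finite V" and sub: "\<And>i. A i \<subseteq> V" and A0: "A 0 = {}"
    and conv: "\<And>v i j k. v \<in> A i \<Longrightarrow> v \<in> A k \<Longrightarrow> i \<le> j \<Longrightarrow> j \<le> k \<Longrightarrow> v \<in> A j"
    and inj: "\<And>i. inj_on x (A i)"
    and f: "\<And>i u v. (u, v) \<in> consecutive x (A i) \<Longrightarrow> f u \<noteq> f v"
  shows "2 * card (\<Union>i\<le>r. consecutive x (A i)) + card (\<Union>i\<le>r. minima x (A i))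
       + card (\<Union>i\<le>r. minima (\<lambda>v. - x v) (A i)) \<le> 4 * card V"
proof -
  have fin: "finite (A i)" for i using V sub finite_subset by blast
  have finm: "finite (minima y (A i))" for y i using fin by (auto simp: minima_def)
  have c: "card (\<Union>i\<le>r. consecutive x (A i))
      \<le> (\<Sum>i<r. card (consecutive x (A (Suc i)) - consecutive x (A i)))"
    using fin by (intro card_UN_increments finite_consecutive) (simp add: A0 consecutive_def)
  have m: "card (\<Union>i\<le>r. minima y (A i)) \<le> (\<Sum>i<r. card (minima y (A (Suc i)) - minima y (A i)))"
    for y
    using finm by (intro card_UN_increments) (simp_all add: A0 minima_def)
  have step: "2 * card (consecutive x (A (Suc i)) - consecutive x (A i))
       + card (minima x (A (Suc i)) - minima x (A i))
       + card (minima (\<lambda>v. - x v) (A (Suc i)) - minima (\<lambda>v. - x v) (A i))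
       \<le> 3 * card (A (Suc i) - A i) + card (A i - A (Suc i))" for i
    by (rule consecutive_step[where f = f]) (use fin inj f in auto)
  have ins: "(\<Sum>i<r. card (A (Suc i) - A i)) \<le> card V"
  proof -
    have "(\<Sum>i<r. card (A (Suc i) - A i)) = card (\<Union>i<r. A (Suc i) - A i)"
    proof (rule card_UN_disjoint[symmetric])
      show "\<forall>i\<in>{..<r}. \<forall>j\<in>{..<r}. i \<noteq> j \<longrightarrow> (A (Suc i) - A i) \<inter> (A (Suc j) - A j) = {}"
      proof (intro ballI impI)
        fix i j :: nat assume "i \<noteq> j"
        \<comment> \<open>An element entering at two different steps would be present, absent and
          present again.\<close>
        then show "(A (Suc i) - A i) \<inter> (A (Suc j) - A j) = {}"
          using conv[of _ "Suc i" "Suc j" j] conv[of _ "Suc j" "Suc i" i] by (cases "i < j") auto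
      qed
    qed (use fin in auto)
    also have "\<dots> \<le> card V" using V sub by (intro card_mono) auto
    finally show ?thesis .
  qed
  have del: "(\<Sum>i<r. card (A i - A (Suc i))) \<le> card V"
  proof -
    have "(\<Sum>i<r. card (A i - A (Suc i))) = card (\<Union>i<r. A i - A (Suc i))"
    proof (rule card_UN_disjoint[symmetric])
      show "\<forall>i\<in>{..<r}. \<forall>j\<in>{..<r}. i \<noteq> j \<longrightarrow> (A i - A (Suc i)) \<inter> (A j - A (Suc j)) = {}"
      proof (intro ballI impI)
        fix i j :: nat assume "i \<noteq> j"
        then show "(A i - A (Suc i)) \<inter> (A j - A (Suc j)) = {}"
          using conv[of _ i j "Suc i"] conv[of _ j i "Suc j"] by (cases "i < j") auto
      qed
    qed (use fin in auto)
    also have "\<dots> \<le> card V" using V sub by (intro card_mono) auto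
    finally show ?thesis .
  qed
  have "(\<Sum>i<r. 2 * card (consecutive x (A (Suc i)) - consecutive x (A i))
       + card (minima x (A (Suc i)) - minima x (A i))
       + card (minima (\<lambda>v. - x v) (A (Suc i)) - minima (\<lambda>v. - x v) (A i)))
       \<le> (\<Sum>i<r. 3 * card (A (Suc i) - A i) + card (A i - A (Suc i)))"
    by (intro sum_mono step)
  then show ?thesis
    using c m[of x] m[of "\<lambda>v. - x v"] ins del
    unfolding sum.distrib sum_distrib_left[symmetric] by linarith
qed

section \<open>Horizontal visibility as consecutiveness among the crossed squares\<close>

lemma interior_unit_square:
  "interior (unit_square p) = {fst p<..<fst p + 1} \<times> {snd p<..<snd p + 1}"
  by (simp add: unit_square_def interior_Times)

lemma hline_meets_square:
  "hline y \<inter> interior (unit_square p) \<noteq> {} \<longleftrightarrow> snd p < y \<and> y < snd p + 1"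
proof
  assume "hline y \<inter> interior (unit_square p) \<noteq> {}"
  then show "snd p < y \<and> y < snd p + 1" by (auto simp: hline_def interior_unit_square)
next
  assume "snd p < y \<and> y < snd p + 1"
  then have "(fst p + 1/2, y) \<in> hline y \<inter> interior (unit_square p)"
    by (simp add: hline_def interior_unit_square)
  then show "hline y \<inter> interior (unit_square p) \<noteq> {}" by blast
qed

text \<open>The inequalities are strict because visibility only concerns lines that meet the
  interior of a square.\<close>

definition active :: "'a set \<Rightarrow> ('a \<Rightarrow> real \<times> real) \<Rightarrow> real \<Rightarrow> 'a set" where
  "active V c t = {v \<in> V. snd (c v) < t \<and> t < snd (c v) + 1}"

text \<open>Otherwise the point at height \<open>t\<close> halfway between the left side of
  \<open>w\<close> and the right side of \<open>v\<close> would be interior to both squares.\<close>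

lemma active_separated:
  assumes disj: "disjoint_family_on (\<lambda>v. interior (unit_square (c v))) V"
    and v: "v \<in> active V c t" and w: "w \<in> active V c t" and ne: "v \<noteq> w"
    and le: "fst (c v) \<le> fst (c w)"
  shows "fst (c v) + 1 \<le> fst (c w)"
proof (rule ccontr)
  assume "\<not> ?thesis"
  then have "((fst (c v) + 1 + fst (c w)) / 2, t)
      \<in> interior (unit_square (c v)) \<inter> interior (unit_square (c w))"
    using v w le by (auto simp: interior_unit_square active_def)
  then show False using disjoint_family_onD[OF disj _ _ ne] v w by (auto simp: active_def)
qed

lemma same_side:
  fixes s t a :: real
  assumes "\<bar>s - t\<bar> < \<bar>t - a\<bar>"
  shows "a < s \<longleftrightarrow> a < t" "s < a \<longleftrightarrow> t < a"
  using assms by (cases "t < a"; simp add: abs_less_iff)+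

text \<open>The crossed set can change only at the finitely many heights of lower and upper sides,
  and \<open>t\<close> has positive distance from all of them.\<close>

lemma active_locally_constant:
  assumes V: "finite V" and t: "\<forall>v\<in>V. t \<noteq> snd (c v) \<and> t \<noteq> snd (c v) + 1"
  shows "\<exists>e>0. \<forall>s. \<bar>s - t\<bar> < e \<longrightarrow> active V c s = active V c t"
proof -
  define N where "N = (snd \<circ> c) ` V \<union> (\<lambda>v. snd (c v) + 1) ` V"
  have "finite N" "t \<notin> N" using V t by (auto simp: N_def)
  then obtain e where e: "e > 0" "\<And>a. a \<in> N \<Longrightarrow> e \<le> dist t a"
    using finite_set_avoid[of N t] by metis
  have "active V c s = active V c t" if s: "\<bar>s - t\<bar> < e" for s
  proof -
    have "\<bar>s - t\<bar> < \<bar>t - a\<bar>" if "a \<in> N" for a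
      using e(2)[OF that] s by (simp add: dist_real_def)
    then have "\<bar>s - t\<bar> < \<bar>t - snd (c v)\<bar>" "\<bar>s - t\<bar> < \<bar>t - (snd (c v) + 1)\<bar>"
      if "v \<in> V" for v using that by (auto simp: N_def)
    from same_side(1)[OF this(1)] same_side(2)[OF this(2)] show ?thesis
      unfolding active_def by blast
  qed
  then show ?thesis using e(1) by blast
qed

text \<open>The interval around \<open>t\<close> on which the crossed set is constant serves as the
  band of visibility.\<close>

lemma consecutive_imp_hvisible:
  assumes V: "finite V"
    and t: "\<forall>v\<in>V. t \<noteq> snd (c v) \<and> t \<noteq> snd (c v) + 1"
    and uv: "(u, v) \<in> consecutive (fst \<circ> c) (active V c t)"
  shows "hvisible V c u v"
proof -
  from active_locally_constant[OF V t] obtain e where e: "e > 0"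
    "\<And>s. \<bar>s - t\<bar> < e \<Longrightarrow> active V c s = active V c t" by blast
  have A: "u \<in> active V c t" "v \<in> active V c t" and lt: "fst (c u) < fst (c v)"
    and mid: "\<And>w. w \<in> active V c t \<Longrightarrow> \<not> (fst (c u) < fst (c w) \<and> fst (c w) < fst (c v))"
    using uv by (auto simp: consecutive_def)
  have "hline y \<inter> interior (unit_square (c u)) \<noteq> {} \<and>
        hline y \<inter> interior (unit_square (c v)) \<noteq> {} \<and>
        (\<forall>w\<in>V - {u, v}. hgap (c u) (c v) y \<inter> interior (unit_square (c w)) = {})"
    if y: "y \<in> {t - e<..<t + e}" for y
  proof -
    have Ay: "active V c y = active V c t" using y by (intro e) auto
    have "hgap (c u) (c v) y \<inter> interior (unit_square (c w)) = {}" if w: "w \<in> V - {u, v}" for w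
    proof (rule ccontr)
      assume "hgap (c u) (c v) y \<inter> interior (unit_square (c w)) \<noteq> {}"
      then obtain p where p: "fst (c u) + 1 \<le> p" "p \<le> fst (c v)"
          "fst (c w) < p" "p < fst (c w) + 1" "snd (c w) < y" "y < snd (c w) + 1"
        using lt by (auto simp: hgap_def interior_unit_square)
      then have wA: "w \<in> active V c t" using w Ay by (auto simp: active_def)
      \<comment> \<open>Because all squares have the same width, a square meeting the gap has its
        left side strictly between those of \<open>u\<close> and \<open>v\<close>.\<close>
      have "fst (c u) < fst (c w)" using p by linarith
      moreover have "fst (c w) < fst (c v)" using p by linarith
      ultimately show False using mid[OF wA] by blast
    qed
    moreover have "u \<in> active V c y" "v \<in> active V c y" using A Ay by auto
    ultimately show ?thesis by (auto simp: hline_meets_square active_def simp del: Int_iff)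
  qed
  then show ?thesis unfolding hvisible_def using e(1)
    by (intro exI[of _ "t - e"] exI[of _ "t + e"]) auto
qed

text \<open>\<open>N\<close> is a finite set of heights to be avoided, later those of the sides. An
  open band has infinitely many heights, so one outside \<open>N\<close> can be chosen.\<close>

lemma hvisible_imp_consecutive:
  assumes disj: "disjoint_family_on (\<lambda>v. interior (unit_square (c v))) V"
    and fin: "finite N" and vis: "hvisible V c u v" and uv: "u \<in> V" "v \<in> V" "u \<noteq> v"
  shows "\<exists>t. t \<notin> N \<and> ((u, v) \<in> consecutive (fst \<circ> c) (active V c t)
                  \<or> (v, u) \<in> consecutive (fst \<circ> c) (active V c t))"
proof -
  obtain a b where ab: "a < b" and band: "\<And>y. y \<in> {a<..<b} \<Longrightarrow>
      hline y \<inter> interior (unit_square (c u)) \<noteq> {} \<and>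
      hline y \<inter> interior (unit_square (c v)) \<noteq> {} \<and>
      (\<forall>w\<in>V - {u, v}. hgap (c u) (c v) y \<inter> interior (unit_square (c w)) = {})"
    using vis by (auto simp: hvisible_def)
  have "infinite ({a<..<b} - N)" using ab fin by (simp add: infinite_Ioo)
  then obtain t where t: "t \<in> {a<..<b}" "t \<notin> N"
    by (metis DiffE all_not_in_conv finite.emptyI)
  have A: "u \<in> active V c t" "v \<in> active V c t"
    using band[OF t(1)] uv unfolding hline_meets_square by (auto simp: active_def)
  have free: "hgap (c u) (c v) t \<inter> interior (unit_square (c w)) = {}" if "w \<in> V - {u, v}" for w
    using band[OF t(1)] that by blast
  have main: "(p, q) \<in> consecutive (fst \<circ> c) (active V c t)"
    if pq: "{p, q} = {u, v}" and le: "fst (c p) \<le> fst (c q)" for p q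
  proof -
    have mem: "p \<in> active V c t" "q \<in> active V c t" "p \<noteq> q" using pq A uv by (auto simp: doubleton_eq_iff)
    have lt: "fst (c p) + 1 \<le> fst (c q)" using active_separated[OF disj mem(1,2,3) le] .
    have hg: "hgap (c u) (c v) t = {fst (c p) + 1..fst (c q)} \<times> {t}"
      using pq lt by (auto simp: hgap_def doubleton_eq_iff)
    have "\<not> (fst (c p) < fst (c w) \<and> fst (c w) < fst (c q))" if w: "w \<in> active V c t" for w
    proof
      assume b: "fst (c p) < fst (c w) \<and> fst (c w) < fst (c q)"
      then have wn: "w \<noteq> p" "w \<noteq> q" by auto
      have "fst (c p) + 1 \<le> fst (c w)" "fst (c w) + 1 \<le> fst (c q)"
        using active_separated[OF disj mem(1) w] active_separated[OF disj w mem(2)] b wn by auto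
      \<comment> \<open>The midpoint of \<open>w\<close> at height \<open>t\<close> lies in the gap,
        since \<open>w\<close> is separated from both ends.\<close>
      then have "(fst (c w) + 1/2, t) \<in> hgap (c u) (c v) t \<inter> interior (unit_square (c w))"
        using w by (auto simp: hg interior_unit_square active_def)
      moreover have "w \<in> V - {u, v}" using w wn pq by (auto simp: active_def)
      ultimately show False using free by blast
    qed
    then show ?thesis using mem lt by (simp add: consecutive_def)
  qed
  show ?thesis
    using main[of u v] main[of v u] t(2) by (meson insert_commute linear)
qed

section \<open>The bound for one direction of sweep\<close>

lemma finite_set_of_representatives:
  assumes "finite (f ` T)"
  obtains S where "finite S" "S \<subseteq> T" "f ` S = f ` T"
  using finite_subset_image[OF assms order_refl] by metis

(* Only finitely many crossed sets occur at generic heights, so the sweep can be sampled at one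
   height for each of them; the empty set is put in front as A 0. *)
lemma horizontal_bound:
  fixes c :: "'a \<Rightarrow> real \<times> real" and f :: "'a \<Rightarrow> bool"
  assumes V: "finite V"
    and disj: "disjoint_family_on (\<lambda>v. interior (unit_square (c v))) V"
    and f: "\<And>v w. v \<in> V \<Longrightarrow> w \<in> V \<Longrightarrow> v \<noteq> w \<Longrightarrow> hvisible V c v w \<Longrightarrow> f v \<noteq> f w"
  obtains D L R where "D \<subseteq> V \<times> V" "L \<subseteq> V" "R \<subseteq> V"
    "\<And>v w. v \<in> V \<Longrightarrow> w \<in> V \<Longrightarrow> v \<noteq> w \<Longrightarrow> hvisible V c v w \<Longrightarrow> (v, w) \<in> D \<or> (w, v) \<in> D"
    "\<And>v. v \<in> V \<Longrightarrow> {snd (c v)<..<snd (c v) + 1} \<subseteq> (\<Union>l\<in>L. {snd (c l)..snd (c l) + 1})"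
    "\<And>v. v \<in> V \<Longrightarrow> {snd (c v)<..<snd (c v) + 1} \<subseteq> (\<Union>r\<in>R. {snd (c r)..snd (c r) + 1})"
    "2 * card D + card L + card R \<le> 4 * card V"
proof -
  define N where "N = (snd \<circ> c) ` V \<union> (\<lambda>v. snd (c v) + 1) ` V"
  have finN: "finite N" using V by (simp add: N_def)
  have gen: "\<forall>v\<in>V. t \<noteq> snd (c v) \<and> t \<noteq> snd (c v) + 1" if "t \<notin> N" for t
    using that by (auto simp: N_def)
  have subV: "active V c t \<subseteq> V" for t by (auto simp: active_def)
  have "finite (active V c ` (- N))"
    by (rule finite_subset[of _ "Pow V"]) (use V subV in auto)
  then obtain S where S: "finite S" "S \<subseteq> - N" "active V c ` S = active V c ` (- N)"
    by (rule finite_set_of_representatives)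
  define xs where "xs = sorted_list_of_set S"
  define A where "A i = (if i = 0 \<or> length xs < i then {} else active V c (xs ! (i - 1)))" for i
  have xs: "set xs = S" "sorted xs" using S by (auto simp: xs_def)
  have A_cases: "A i = {} \<or> (\<exists>t. t \<notin> N \<and> A i = active V c t)" for i
  proof (cases "i = 0 \<or> length xs < i")
    case False
    then have "xs ! (i - 1) \<in> S" using xs nth_mem[of "i - 1" xs] by auto
    then show ?thesis using False S by (auto simp: A_def)
  qed (auto simp: A_def)
  have A_hit: "\<exists>i\<le>length xs. A i = active V c t" if "t \<notin> N" for t
  proof -
    have "active V c t \<in> active V c ` S" using S that by auto
    then obtain s where s: "s \<in> set xs" "active V c s = active V c t" using xs by auto
    then obtain j where j: "j < length xs" "xs ! j = s" by (auto simp: in_set_conv_nth)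
    then show ?thesis using s by (intro exI[of _ "Suc j"]) (auto simp: A_def)
  qed
  have inj: "inj_on (fst \<circ> c) (active V c t)" for t
  proof (rule inj_onI, rule ccontr)
    fix v w assume "v \<in> active V c t" "w \<in> active V c t" "(fst \<circ> c) v = (fst \<circ> c) w" "v \<noteq> w"
    then show False using active_separated[OF disj, of v t w] by auto
  qed
  define D where "D = (\<Union>i\<le>length xs. consecutive (fst \<circ> c) (A i))"
  define L where "L = (\<Union>i\<le>length xs. minima (fst \<circ> c) (A i))"
  define R where "R = (\<Union>i\<le>length xs. minima (\<lambda>v. - (fst \<circ> c) v) (A i))"
  have AV: "A i \<subseteq> V" for i using subV by (auto simp: A_def)
  have bound: "2 * card D + card L + card R \<le> 4 * card V"
    unfolding D_def L_def R_def
  proof (rule sweep_bound[where f = f])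
    \<comment> \<open>Membership at \<open>i\<close> and \<open>k\<close> excludes the empty sets at
      index 0 and beyond the list. The samples are sorted, and the heights crossing a given square
      form an interval.\<close>
    fix v i j k assume a: "v \<in> A i" "v \<in> A k" "i \<le> j" "j \<le> k"
    then have r: "i \<noteq> 0" "k \<le> length xs" by (auto simp: A_def split: if_splits)
    then have "xs ! (i - 1) \<le> xs ! (j - 1)" "xs ! (j - 1) \<le> xs ! (k - 1)"
      using a xs(2) by (auto intro!: sorted_nth_mono)
    then show "v \<in> A j" using a r by (auto simp: A_def active_def split: if_splits)
  next
    fix i show "inj_on (fst \<circ> c) (A i)" using inj by (simp add: A_def)
  next
    fix i u v assume uv: "(u, v) \<in> consecutive (fst \<circ> c) (A i)"
    then have "A i \<noteq> {}" by (auto simp: consecutive_def)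
    then obtain t where t: "t \<notin> N" "A i = active V c t" using A_cases by blast
    then have "hvisible V c u v"
      using uv gen by (intro consecutive_imp_hvisible[OF V, of t]) auto
    moreover have "u \<in> V" "v \<in> V" "u \<noteq> v" using uv AV by (auto simp: consecutive_def)
    ultimately show "f u \<noteq> f v" using f by blast
  qed (use V AV in \<open>auto simp: A_def\<close>)
  \<comment> \<open>The arbitrary key \<open>k\<close> lets the same argument serve leftmost and
    rightmost squares.\<close>
  have cover: "{snd (c v)<..<snd (c v) + 1}
      \<subseteq> (\<Union>l\<in>(\<Union>i\<le>length xs. minima k (A i)). {snd (c l)..snd (c l) + 1})" (is "_ \<subseteq> ?U")
    if v: "v \<in> V" for v and k :: "'a \<Rightarrow> real"
  proof
    fix y assume y: "y \<in> {snd (c v)<..<snd (c v) + 1}"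
    have genU: "t \<in> ?U" if t: "t \<notin> N" "t \<in> {snd (c v)<..<snd (c v) + 1}" for t
    proof -
      obtain i where i: "i \<le> length xs" "A i = active V c t" using A_hit t by blast
      have "v \<in> A i" using i v t by (auto simp: active_def)
      then obtain l where l: "l \<in> minima k (A i)"
        using minima_nonempty[of "A i" k] finite_subset[OF AV V] by blast
      then have "t \<in> {snd (c l)..snd (c l) + 1}" using i by (auto simp: minima_def active_def)
      then show ?thesis using l i by blast
    qed
    have "finite (\<Union>i\<le>length xs. minima k (A i))"
      using finite_subset[OF AV V] by (auto simp: minima_def)
    \<comment> \<open>Generic heights are covered by \<open>genU\<close>. The union of closed
      intervals is closed, so an uncovered height would leave a nonempty open set, hence infinitely
      many uncovered heights, one of them outside \<open>N\<close>.\<close>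
    then have "closed ?U" by (intro closed_UN) auto
    then have op: "open ({snd (c v)<..<snd (c v) + 1} - ?U)" by (intro open_Diff) auto
    show "y \<in> ?U"
    proof (rule ccontr)
      assume "y \<notin> ?U"
      then have "infinite ({snd (c v)<..<snd (c v) + 1} - ?U)"
        using op y finite_imp_not_open by blast
      then obtain t where "t \<in> {snd (c v)<..<snd (c v) + 1} - ?U" "t \<notin> N"
        using finN by (meson finite_subset subsetI)
      then show False using genU by blast
    qed
  qed
  show ?thesis
  proof (rule that[of D L R])
    show "D \<subseteq> V \<times> V" using AV by (fastforce simp: D_def consecutive_def)
    show "L \<subseteq> V" "R \<subseteq> V" using AV by (auto simp: L_def R_def minima_def)
    show "(v, w) \<in> D \<or> (w, v) \<in> D" if vw: "v \<in> V" "w \<in> V" "v \<noteq> w" "hvisible V c v w" for v w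
    proof -
      obtain t where t: "t \<notin> N" "(v, w) \<in> consecutive (fst \<circ> c) (active V c t)
          \<or> (w, v) \<in> consecutive (fst \<circ> c) (active V c t)"
        using hvisible_imp_consecutive[OF disj finN vw(4) vw(1-3)] by blast
      obtain i where "i \<le> length xs" "A i = active V c t" using A_hit t by blast
      then have "consecutive (fst \<circ> c) (active V c t) \<subseteq> D"
        unfolding D_def by (metis UN_upper atMost_iff)
      then show ?thesis using t(2) by blast
    qed
  qed (use bound cover in \<open>simp_all add: L_def R_def\<close>)
qed

section \<open>Area comparison and the final count\<close>

text \<open>The disjoint interiors have area 1 each and lie in the product of a union of
  \<open>card B\<close> unit intervals and one of \<open>card L\<close> unit intervals.\<close>

lemma area_bound:
  fixes c :: "'a \<Rightarrow> real \<times> real"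
  assumes V: "finite V"
    and disj: "disjoint_family_on (\<lambda>v. interior (unit_square (c v))) V"
    and fin: "finite B" "finite L"
    and B: "\<And>v. v \<in> V \<Longrightarrow> {fst (c v)<..<fst (c v) + 1} \<subseteq> (\<Union>b\<in>B. {fst (c b)..fst (c b) + 1})"
    and L: "\<And>v. v \<in> V \<Longrightarrow> {snd (c v)<..<snd (c v) + 1} \<subseteq> (\<Union>l\<in>L. {snd (c l)..snd (c l) + 1})"
  shows "card V \<le> card B * card L"
proof -
  define X where "X = (\<Union>b\<in>B. {fst (c b)..fst (c b) + 1})"
  define Y where "Y = (\<Union>l\<in>L. {snd (c l)..snd (c l) + 1})"
  have interval_union: "emeasure lborel (\<Union>i\<in>I. {g i..g i + 1}) \<le> of_nat (card I)"
    if "finite I" for I :: "'a set" and g :: "'a \<Rightarrow> real"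
  proof -
    have "emeasure lborel (\<Union>i\<in>I. {g i..g i + 1}) \<le> (\<Sum>i\<in>I. emeasure lborel {g i..g i + 1})"
      using that by (intro emeasure_subadditive_finite) auto
    then show ?thesis by simp
  qed
  have meas: "X \<in> sets borel" "Y \<in> sets borel" using fin by (auto simp: X_def Y_def)
  have sq: "emeasure lborel (interior (unit_square (c v))) = 1" for v
  proof -
    have "emeasure (lborel :: (real \<times> real) measure) (interior (unit_square (c v)))
        = emeasure (lborel \<Otimes>\<^sub>M lborel) ({fst (c v)<..<fst (c v) + 1} \<times> {snd (c v)<..<snd (c v) + 1})"
      by (simp add: interior_unit_square lborel_prod)
    also have "\<dots> = 1" by (subst lborel.emeasure_pair_measure_Times) auto
    finally show ?thesis .
  qed
  have "of_nat (card V) = (\<Sum>v\<in>V. emeasure lborel (interior (unit_square (c v))))"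
    by (simp add: sq)
  also have "\<dots> = emeasure lborel (\<Union>v\<in>V. interior (unit_square (c v)))"
    using V disj by (intro sum_emeasure) auto
  also have "\<dots> \<le> emeasure lborel (X \<times> Y)"
  proof (rule emeasure_mono)
    show "(\<Union>v\<in>V. interior (unit_square (c v))) \<subseteq> X \<times> Y"
      unfolding interior_unit_square X_def Y_def using B L by blast
    show "X \<times> Y \<in> sets lborel" using meas by (simp add: borel_Times)
  qed
  also have "\<dots> = emeasure (lborel \<Otimes>\<^sub>M lborel) (X \<times> Y)" by (simp add: lborel_prod)
  also have "\<dots> = emeasure lborel X * emeasure lborel Y"
    using meas by (intro lborel.emeasure_pair_measure_Times) auto
  also have "\<dots> \<le> of_nat (card B) * of_nat (card L)"
    unfolding X_def Y_def using fin by (intro mult_mono interval_union) auto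
  also have "\<dots> = of_nat (card B * card L)" by simp
  finally show ?thesis by (simp only: of_nat_le_iff)
qed

lemma two_sqrt_le_add:
  fixes a b n :: nat
  assumes "n \<le> a * b"
  shows "2 * sqrt (real n) \<le> real a + real b"
proof -
  have "sqrt (real n) \<le> sqrt (real a * real b)"
    using assms by (simp flip: of_nat_mult)
  also have "\<dots> \<le> (real a + real b) / 2" by (rule arith_geo_mean_sqrt) auto
  finally show ?thesis by simp
qed

theorem theorem6p6:
  fixes V :: "'a set" and E :: "'a set set" and n :: nat
  assumes "n \<ge> 7"
    and "urvg V E"
    and "card V = n"
    and "bipartite V E"
  shows "int (card E) \<le> 4 * int n - 2 * \<lceil>sqrt (real n)\<rceil> + 5"
proof -
  obtain c where rep: "urv_representation V E c" and V: "finite V"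
    and E: "E \<subseteq> {{u, v} | u v. u \<in> V \<and> v \<in> V \<and> u \<noteq> v}"
    using assms by (auto simp: urvg_def simple_graph_def)
  obtain A B where AB: "A \<inter> B = {}" "\<And>e. e \<in> E \<Longrightarrow> \<exists>a\<in>A. \<exists>b\<in>B. e = {a, b}"
    using assms by (auto simp: bipartite_def)
  \<comment> \<open>Exchanging the coordinates turns vertical visibility into horizontal visibility,
    so the same bound applies twice.\<close>
  define c' where "c' = prod.swap \<circ> c"
  have disj: "disjoint_family_on (\<lambda>v. interior (unit_square (c v))) V"
    using rep by (simp add: urv_representation_def disjoint_family_on_def)
  then have disj': "disjoint_family_on (\<lambda>v. interior (unit_square (c' v))) V"
    unfolding disjoint_family_on_def interior_unit_square c'_def Times_Int_Times Times_empty
    by (simp add: disj_commute)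
  have edge: "{v, w} \<in> E \<longleftrightarrow> hvisible V c v w \<or> hvisible V c' v w"
    if "v \<in> V" "w \<in> V" "v \<noteq> w" for v w
    using rep that by (auto simp: urv_representation_def vvisible_def c'_def)
  \<comment> \<open>Membership in the class \<open>A\<close> is the two-colouring \<open>f\<close>
    used by both sweeps.\<close>
  have col: "(v \<in> A) \<noteq> (w \<in> A)" if vw: "{v, w} \<in> E" for v w
    using AB(1) AB(2)[OF vw] by (auto simp: doubleton_eq_iff)
  obtain D L R where H: "D \<subseteq> V \<times> V" "L \<subseteq> V" "R \<subseteq> V"
    "\<And>v w. v \<in> V \<Longrightarrow> w \<in> V \<Longrightarrow> v \<noteq> w \<Longrightarrow> hvisible V c v w \<Longrightarrow> (v, w) \<in> D \<or> (w, v) \<in> D"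
    "\<And>v. v \<in> V \<Longrightarrow> {snd (c v)<..<snd (c v) + 1} \<subseteq> (\<Union>l\<in>L. {snd (c l)..snd (c l) + 1})"
    "\<And>v. v \<in> V \<Longrightarrow> {snd (c v)<..<snd (c v) + 1} \<subseteq> (\<Union>r\<in>R. {snd (c r)..snd (c r) + 1})"
    "2 * card D + card L + card R \<le> 4 * card V"
    by (rule horizontal_bound[OF V disj, where f = "\<lambda>v. v \<in> A"]) (use col edge in auto)
  obtain D' L' R' where H': "D' \<subseteq> V \<times> V" "L' \<subseteq> V" "R' \<subseteq> V"
    "\<And>v w. v \<in> V \<Longrightarrow> w \<in> V \<Longrightarrow> v \<noteq> w \<Longrightarrow> hvisible V c' v w \<Longrightarrow> (v, w) \<in> D' \<or> (w, v) \<in> D'"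
    "\<And>v. v \<in> V \<Longrightarrow> {snd (c' v)<..<snd (c' v) + 1} \<subseteq> (\<Union>l\<in>L'. {snd (c' l)..snd (c' l) + 1})"
    "\<And>v. v \<in> V \<Longrightarrow> {snd (c' v)<..<snd (c' v) + 1} \<subseteq> (\<Union>r\<in>R'. {snd (c' r)..snd (c' r) + 1})"
    "2 * card D' + card L' + card R' \<le> 4 * card V"
    by (rule horizontal_bound[OF V disj', where f = "\<lambda>v. v \<in> A"]) (use col edge in auto)
  have snd_c': "snd (c' v) = fst (c v)" for v by (simp add: c'_def)
  have fins: "finite D" "finite D'" "finite L" "finite R" "finite L'" "finite R'"
    using H(1-3) H'(1-3) V by (auto intro: finite_subset)
  have "E \<subseteq> (\<lambda>(u, v). {u, v}) ` (D \<union> D')"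
  proof
    fix e assume e: "e \<in> E"
    then obtain u v where uv: "e = {u, v}" "u \<in> V" "v \<in> V" "u \<noteq> v" using E by auto
    then have "(u, v) \<in> D \<union> D' \<or> (v, u) \<in> D \<union> D'"
      using edge[of u v] e H(4)[of u v] H'(4)[of u v] by auto
    then show "e \<in> (\<lambda>(u, v). {u, v}) ` (D \<union> D')"
      using uv(1) by (force simp: insert_commute)
  qed
  then have "card E \<le> card (D \<union> D')" using fins by (intro surj_card_le) auto
  also have "\<dots> \<le> card D + card D'" by (rule card_Un_le)
  finally have cE: "card E \<le> card D + card D'" .
  \<comment> \<open>\<open>L'\<close> and \<open>R'\<close> each cover the horizontal projections,
    \<open>L\<close> and \<open>R\<close> the vertical ones.\<close>
  have "n \<le> card L' * card L" "n \<le> card R' * card R"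
    unfolding assms(3)[symmetric]
    using area_bound[OF V disj, of L' L] area_bound[OF V disj, of R' R]
      H(5,6) H'(5,6)[unfolded snd_c'] fins by simp_all
  from this[THEN two_sqrt_le_add]
  have "4 * sqrt (real n) \<le> real (card L + card R + (card L' + card R'))" by simp
  moreover have "real (2 * card E + (card L + card R + (card L' + card R'))) \<le> real (8 * n)"
    unfolding of_nat_le_iff using cE H(7) H'(7) assms(3) by linarith
  ultimately have "real (card E) \<le> 4 * real n - 2 * sqrt (real n)" by simp
  \<comment> \<open>Rounding the square root up costs less than 1, so its double costs less than 2,
    which the additive 5 absorbs.\<close>
  then show ?thesis by linarith
qed

end
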